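(* Consider the Generalized Multiple Strip Packing Problem and its normal-position master. Let $i\in\mathcal I$ be a strip, let $C\subseteq\mathcal J$ be a set of items with positions $p^s_j\in\mathcal W_i(j)$ ($j\in C$) on strip $i$, and let $t$ be a nonnegative integer such that the y-check for $C$ at positions $(p^s_j)_{j\in C}$ on strip $i$ is infeasible for target height $t$. Put $\bar t=t+1$. Then the inequality $$\bar t\sum_{j\in C}x_{ijp^s_j}-H_i\ \le\ \bar t\,\bigl(|C|-1\bigr)$$ is valid, under either objective (total area $\sum_iW_iH_i$ or makespan $\max_iH_i$): it is satisfied by every integer-feasible solution $(x,H)$ of the master that is realizable by a packing.
   Context: **Instance.** Items $\mathcal J=\{1,\dots,n\}$, strips $\mathcal I=\{1,\dots,m\}$; strip $i$ has positive integer width $W_i$ and infinite height. Item $j$, if assigned to strip $i$, is a rectangle of positive integer width $w_{ij}$ and positive integer height $h_{ij}$. Item $j$ may be packed in strip $i$ only if $w_{ij}\le W_i$ (then the pair $(i,j)$ is called eligible); every item is eligible for at least one strip. In the problem, each item is packed exactly once in some strip, without overlap, without rotation, with edges parallel to the strip borders; $H_i\ge0$ denotes the height of strip $i$, and one minimizes $\sum_iW_iH_i$ or $\max_iH_i$. **Normal positions.** For an eligible pair $(i,j)$, $\mathcal W_i(j)$ is the set of $p\in\{0,\dots,W_i-w_{ij}\}$ that can be written as $\sum_{k\in S}w_{ik}$ for some subset $S\subseteq\mathcal J\setminus\{j\}$ (the empty sum $0$ is allowed); for non-eligible pairs $\mathcal W_i(j)=\emptyset$. For $q\in\{0,\dots,W_i-1\}$,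 $\mathcal W_i(j,q)=\{p\in\mathcal W_i(j): p\le q\le p+w_{ij}-1\}$. **Master.** Variables $x_{ijp}\in\{0,1\}$ ($x_{ijp}=1$ means that the left edge of item $j$ is at horizontal position $p\in\mathcal W_i(j)$ on strip $i$) and real $H_i\ge 0$; minimize $\sum_iW_iH_i$ or $\max_iH_i$ subject to - $\sum_{i}\sum_{p\in\mathcal W_i(j)}x_{ijp}=1$ for all $j\in\mathcal J$; - $\sum_{j}\sum_{p\in\mathcal W_i(j,q)}h_{ij}x_{ijp}\le H_i$ for all $i\in\mathcal I$, $q\in\{0,\dots,W_i-1\}$. **y-check.** Given a strip $i$, a set $C$ of items with fixed horizontal positions $p_j$ ($j\in C$) and a target height $t$, the y-check asks whether there exist vertical coordinates $y_j\ge0$ with $y_j+h_{ij}\le t$ for all $j\in C$ such that the rectangles $[p_j,p_j+w_{ij})\times[y_j,y_j+h_{ij})$, $j\in C$, are pairwise disjoint. It is infeasible for $t$ if no such coordinates exist. **Realizable.** An integer-feasible master solution $(x,H)$ is realizable by a packing if, for every strip $i$, the y-check for the items assigned to strip $i$ by $x$, at the positions given by $x$, is feasible for target height $H_i$. *)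

theory Defs
  imports Complex_Main "HOL-Library.Disjoint_Sets"
begin

record gmsp =
  num_items :: nat
  num_strips :: nat
  strip_width :: "nat \<Rightarrow> nat"
  item_width :: "nat \<Rightarrow> nat \<Rightarrow> nat"   (* strip, item *)
  item_height :: "nat \<Rightarrow> nat \<Rightarrow> nat"  (* strip, item *)

definition items :: "gmsp \<Rightarrow> nat set" where
  "items G = {1..num_items G}"

definition strips :: "gmsp \<Rightarrow> nat set" where
  "strips G = {1..num_strips G}"

definition eligible :: "gmsp \<Rightarrow> nat \<Rightarrow> nat \<Rightarrow> bool" where
  "eligible G i j \<longleftrightarrow> item_width G i j \<le> strip_width G i"

definition gmsp_instance :: "gmsp \<Rightarrow> bool" where
  "gmsp_instance G \<longleftrightarrow>
     (\<forall>i\<in>strips G. 0 < strip_width G i) \<and>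
     (\<forall>i\<in>strips G. \<forall>j\<in>items G. 0 < item_width G i j \<and> 0 < item_height G i j) \<and>
     (\<forall>j\<in>items G. \<exists>i\<in>strips G. eligible G i j)"

definition normal_positions :: "gmsp \<Rightarrow> nat \<Rightarrow> nat \<Rightarrow> nat set" where
  "normal_positions G i j =
     (if eligible G i j
      then {p \<in> {0..strip_width G i - item_width G i j}.
              \<exists>S \<subseteq> items G - {j}. p = (\<Sum>k\<in>S. item_width G i k)}
      else {})"

definition normal_positions_covering :: "gmsp \<Rightarrow> nat \<Rightarrow> nat \<Rightarrow> nat \<Rightarrow> nat set" where
  "normal_positions_covering G i j q =
     {p \<in> normal_positions G i j. p \<le> q \<and> q \<le> p + item_width G i j - 1}"

text \<open>A master solution is a pair (x, H): x i j p is the variable of strip i, item j and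
  position p, and only the values at p in the normal positions of (i, j) are meaningful.\<close>

type_synonym master_solution = "(nat \<Rightarrow> nat \<Rightarrow> nat \<Rightarrow> real) \<times> (nat \<Rightarrow> real)"

definition master_feasible :: "gmsp \<Rightarrow> master_solution set" where
  "master_feasible G = {(x, H).
     (\<forall>i\<in>strips G. \<forall>j\<in>items G. \<forall>p\<in>normal_positions G i j. x i j p \<in> {0, 1}) \<and>
     (\<forall>i\<in>strips G. 0 \<le> H i) \<and>
     (\<forall>j\<in>items G. (\<Sum>i\<in>strips G. \<Sum>p\<in>normal_positions G i j. x i j p) = 1) \<and>
     (\<forall>i\<in>strips G. \<forall>q\<in>{0..<strip_width G i}.
        (\<Sum>j\<in>items G. \<Sum>p\<in>normal_positions_covering G i j q.
           real (item_height G i j) * x i j p) \<le> H i)}"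

datatype objective = Total_Area | Makespan

fun objective_value :: "gmsp \<Rightarrow> objective \<Rightarrow> master_solution \<Rightarrow> real" where
  "objective_value G Total_Area (x, H) = (\<Sum>i\<in>strips G. real (strip_width G i) * H i)"
| "objective_value G Makespan (x, H) = Max (H ` strips G)"

record 'a minimization_problem =
  cost :: "'a \<Rightarrow> real"
  feasible :: "'a set"

definition master :: "gmsp \<Rightarrow> objective \<Rightarrow> master_solution minimization_problem" where
  "master G obj = \<lparr>cost = objective_value G obj, feasible = master_feasible G\<rparr>"

definition rectangle :: "gmsp \<Rightarrow> nat \<Rightarrow> nat \<Rightarrow> nat \<Rightarrow> real \<Rightarrow> (real \<times> real) set" where
  "rectangle G i j p y =
     {real p..<real p + real (item_width G i j)} \<times> {y..<y + real (item_height G i j)}"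

definition y_check :: "gmsp \<Rightarrow> nat \<Rightarrow> nat set \<Rightarrow> (nat \<Rightarrow> nat) \<Rightarrow> real \<Rightarrow> bool" where
  "y_check G i C pos t \<longleftrightarrow>
     (\<exists>y :: nat \<Rightarrow> real.
        (\<forall>j\<in>C. 0 \<le> y j \<and> y j + real (item_height G i j) \<le> t) \<and>
        disjoint_family_on (\<lambda>j. rectangle G i j (pos j) (y j)) C)"

definition assigned_items :: "gmsp \<Rightarrow> (nat \<Rightarrow> nat \<Rightarrow> nat \<Rightarrow> real) \<Rightarrow> nat \<Rightarrow> nat set" where
  "assigned_items G x i = {j \<in> items G. \<exists>p\<in>normal_positions G i j. x i j p = 1}"

text \<open>For a feasible solution the position below is unique, by the assignment constraint of
  item j, so the description operator is well defined on assigned items.\<close>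

definition assigned_position ::
    "gmsp \<Rightarrow> (nat \<Rightarrow> nat \<Rightarrow> nat \<Rightarrow> real) \<Rightarrow> nat \<Rightarrow> nat \<Rightarrow> nat" where
  "assigned_position G x i j = (THE p. p \<in> normal_positions G i j \<and> x i j p = 1)"

definition realizable :: "gmsp \<Rightarrow> master_solution \<Rightarrow> bool" where
  "realizable G = (\<lambda>(x, H). \<forall>i\<in>strips G.
     y_check G i (assigned_items G x i) (assigned_position G x i) (H i))"

end

(* If all the x-variables of the cut are 1, the vertical coordinates of the packing of strip i
   form a feasible y-check for C with real target height H i. All item heights are integers, so
   rounding the coordinates down keeps the rectangles disjoint and makes every top edge an
   integer that is at most H i; infeasibility for the integer t thus forces H i >= t + 1.
   Otherwise the sum is at most |C| - 1 and H i >= 0 suffices. *)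
theory Submission
  imports Defs
begin

text \<open>Positive sides make both rectangles nonempty, so disjointness amounts to separation
  along one axis. This yields inequalities that can be rounded.\<close>

lemma rectangle_disjoint_iff:
  assumes "0 < item_width G i j" "0 < item_height G i j"
    and "0 < item_width G i k" "0 < item_height G i k"
  shows "rectangle G i j p y \<inter> rectangle G i k q z = {} \<longleftrightarrow>
    p + item_width G i j \<le> q \<or> q + item_width G i k \<le> p \<or>
    y + real (item_height G i j) \<le> z \<or> z + real (item_height G i k) \<le> y"
  using assms
  by (auto simp: rectangle_def Times_Int_Times Times_empty min_le_iff_disj le_max_iff_disj
      simp flip: of_nat_add)

text \<open>Serves twice: to pass from all items of the strip to \<open>C\<close>, and to raise the
  target height in the contradiction with infeasibility at \<open>t\<close>.\<close>

lemma y_check_mono: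
  assumes "y_check G i D pos s" "C \<subseteq> D" "\<And>j. j \<in> C \<Longrightarrow> pos' j = pos j" "s \<le> t"
  shows "y_check G i C pos' t"
proof -
  obtain y where y: "\<And>j. j \<in> D \<Longrightarrow> 0 \<le> y j \<and> y j + real (item_height G i j) \<le> s"
    "disjoint_family_on (\<lambda>j. rectangle G i j (pos j) (y j)) D"
    using assms(1) unfolding y_check_def by blast
  have "disjoint_family_on (\<lambda>j. rectangle G i j (pos' j) (y j)) C"
    using disjoint_family_on_mono[OF assms(2) y(2)] assms(3)
    by (simp add: disjoint_family_on_def)
  moreover have "0 \<le> y j \<and> y j + real (item_height G i j) \<le> t" if "j \<in> C" for j
    using y(1)[of j] that assms(2,4) by auto
  ultimately show ?thesis
    unfolding y_check_def by blast
qed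

lemma y_check_floor:
  assumes "y_check G i C pos s"
    and pos: "\<And>j. j \<in> C \<Longrightarrow> 0 < item_width G i j \<and> 0 < item_height G i j"
  shows "y_check G i C pos (of_int \<lfloor>s\<rfloor>)"
proof -
  obtain y where y: "\<And>j. j \<in> C \<Longrightarrow> 0 \<le> y j \<and> y j + real (item_height G i j) \<le> s"
    "disjoint_family_on (\<lambda>j. rectangle G i j (pos j) (y j)) C"
    using assms(1) unfolding y_check_def by blast
  define z :: "nat \<Rightarrow> real" where "z = (\<lambda>j. of_int \<lfloor>y j\<rfloor>)"
  \<comment> \<open>Floor is monotone and commutes with adding an integer. This handles both the
    vertical separation of two items and the bound on each top edge.\<close>
  have shift: "of_int \<lfloor>a\<rfloor> + real h \<le> of_int \<lfloor>b\<rfloor>" if "a + real h \<le> b" for a b :: real and h :: nat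
  proof -
    have "\<lfloor>a\<rfloor> + int h \<le> \<lfloor>b\<rfloor>"
      using that by linarith
    then have "real_of_int (\<lfloor>a\<rfloor> + int h) \<le> of_int \<lfloor>b\<rfloor>"
      by (simp only: of_int_le_iff)
    then show ?thesis
      by simp
  qed
  have "disjoint_family_on (\<lambda>j. rectangle G i j (pos j) (z j)) C"
    unfolding disjoint_family_on_def
  proof (intro ballI impI)
    fix j k assume jk: "j \<in> C" "k \<in> C" "j \<noteq> k"
    have "rectangle G i j (pos j) (y j) \<inter> rectangle G i k (pos k) (y k) = {}"
      using y(2) jk by (auto simp: disjoint_family_on_def)
    \<comment> \<open>Horizontal separation is untouched, since only the vertical coordinates are
      rounded; vertical separation survives by \<open>shift\<close>.\<close>
    then show "rectangle G i j (pos j) (z j) \<inter> rectangle G i k (pos k) (z k) = {}"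
      using pos[OF jk(1)] pos[OF jk(2)] shift
      by (auto simp: rectangle_disjoint_iff z_def)
  qed
  moreover have "0 \<le> z j \<and> z j + real (item_height G i j) \<le> of_int \<lfloor>s\<rfloor>" if "j \<in> C" for j
    using y(1)[OF that] shift by (simp add: z_def)
  ultimately show ?thesis
    unfolding y_check_def by blast
qed

lemma finite_normal_positions: "finite (normal_positions G i j)"
  by (simp add: normal_positions_def)

lemma master_feasible_binary:
  assumes "(x, H) \<in> master_feasible G" "i \<in> strips G" "j \<in> items G" "p \<in> normal_positions G i j"
  shows "x i j p \<in> {0, 1}"
  using assms unfolding master_feasible_def by auto

text \<open>Two positions with value 1 would already contribute 2 to the assignment constraint of
  item \<open>j\<close>, whose terms are nonnegative and add up to 1.\<close>

lemma master_feasible_unique_position: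
  assumes feas: "(x, H) \<in> master_feasible G" and i: "i \<in> strips G" and j: "j \<in> items G"
    and p: "p \<in> normal_positions G i j" "x i j p = 1"
    and q: "q \<in> normal_positions G i j" "x i j q = 1"
  shows "p = q"
proof (rule ccontr)
  assume "p \<noteq> q"
  note bin = master_feasible_binary[OF feas _ j]
  have nonneg: "0 \<le> x k j r" if "k \<in> strips G" "r \<in> normal_positions G k j" for k r
    using bin[OF that] by auto
  have "2 = (\<Sum>r\<in>{p, q}. x i j r)"
    using \<open>p \<noteq> q\<close> p q by simp
  also have "\<dots> \<le> (\<Sum>r\<in>normal_positions G i j. x i j r)"
    using p q i nonneg by (intro sum_mono2 finite_normal_positions) auto
  also have "\<dots> \<le> (\<Sum>k\<in>strips G. \<Sum>r\<in>normal_positions G k j. x k j r)"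
    using i nonneg by (intro member_le_sum) (auto simp: strips_def intro!: sum_nonneg)
  also have "\<dots> = 1"
    using feas j unfolding master_feasible_def by auto
  finally show False
    by simp
qed

text \<open>Resolves the description operator, so that the positions in the y-check of
  \<open>realizable\<close> can be matched with those of the cut.\<close>

lemma assigned_position_eq:
  assumes "(x, H) \<in> master_feasible G" "i \<in> strips G" "j \<in> items G"
    and "p \<in> normal_positions G i j" "x i j p = 1"
  shows "assigned_position G x i j = p"
  unfolding assigned_position_def
  using assms master_feasible_unique_position[OF assms(1-3)] by (intro the_equality) auto

theorem proposition4:
  fixes G :: gmsp and obj :: objective
    and i t tbar :: nat and C :: "nat set" and ps :: "nat \<Rightarrow> nat"
    and x :: "nat \<Rightarrow> nat \<Rightarrow> nat \<Rightarrow> real" and H :: "nat \<Rightarrow> real"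
  assumes "gmsp_instance G"
    and "i \<in> strips G"
    and "C \<subseteq> items G"
    and "\<And>j. j \<in> C \<Longrightarrow> ps j \<in> normal_positions G i j"
    and "\<not> y_check G i C ps (real t)"
    and "tbar = t + 1"
    and "(x, H) \<in> feasible (master G obj)"
    and "realizable G (x, H)"
  shows "real tbar * (\<Sum>j\<in>C. x i j (ps j)) - H i \<le> real tbar * (real (card C) - 1)"
proof -
  have feas: "(x, H) \<in> master_feasible G"
    using assms(7) by (simp add: master_def)
  have H0: "0 \<le> H i"
    using feas assms(2) by (auto simp: master_feasible_def)
  have fin: "finite C"
    using assms(3) finite_subset by (auto simp: items_def)
  have bin: "x i j (ps j) \<in> {0, 1}" if "j \<in> C" for j
    using master_feasible_binary[OF feas assms(2) _ assms(4)] that assms(3) by blast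
  show ?thesis
  proof (cases "\<forall>j\<in>C. x i j (ps j) = 1")
    case True
    have "y_check G i (assigned_items G x i) (assigned_position G x i) (H i)"
      using assms(2,8) by (simp add: realizable_def)
    moreover have "C \<subseteq> assigned_items G x i"
      using True assms(3,4) by (auto simp: assigned_items_def)
    moreover have "ps j = assigned_position G x i j" if "j \<in> C" for j
      using assigned_position_eq[OF feas assms(2) _ assms(4)] True that assms(3) by auto
    ultimately have "y_check G i C ps (H i)"
      by (rule y_check_mono) simp_all
    then have floor: "y_check G i C ps (of_int \<lfloor>H i\<rfloor>)"
      by (rule y_check_floor) (use assms(1-3) in \<open>auto simp: gmsp_instance_def\<close>)
    have "\<not> real_of_int \<lfloor>H i\<rfloor> \<le> real t"
      using y_check_mono[OF floor] assms(5) by blast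
    \<comment> \<open>Both sides are integers, so the strict inequality gains a full unit, which
      gives \<open>tbar\<close>; without rounding only \<open>H i > t\<close> would follow.\<close>
    then have "int t < \<lfloor>H i\<rfloor>"
      by linarith
    then have "real tbar \<le> H i"
      using assms(6) by linarith
    moreover have "(\<Sum>j\<in>C. x i j (ps j)) = real (card C)"
      using True by simp
    ultimately show ?thesis
      by (simp add: algebra_simps)
  next
    case False
    \<comment> \<open>A binary variable that differs from 1 is 0; dropping it leaves
      \<open>card C - 1\<close> terms, each at most 1.\<close>
    then obtain k where k: "k \<in> C" "x i k (ps k) = 0"
      using bin by blast
    have "(\<Sum>j\<in>C. x i j (ps j)) = (\<Sum>j\<in>C - {k}. x i j (ps j))"
      using k fin by (simp add: sum.remove)
    also have "\<dots> \<le> (\<Sum>j\<in>C - {k}. 1)"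
      using bin by (intro sum_mono) fastforce
    also have "\<dots> = real (card C) - 1"
      using card_Suc_Diff1[OF fin k(1)] unfolding sum_constant by linarith
    finally have "real tbar * (\<Sum>j\<in>C. x i j (ps j)) \<le> real tbar * (real (card C) - 1)"
      by (rule mult_left_mono) simp
    with H0 show ?thesis
      by linarith
  qed
qed

end
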